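(* For any $A\subset\mathbb R^n$ there exists a $K_\sigma$-set $A_0\subset A$ (a countable union of compact sets) such that $\mu^A=\mu^{A_0}$ for all $\mu\in\mathfrak M^+$. Consequently $A^r=(A_0)^r$.
   Context: Standing assumptions: $n\ge3$, $\alpha\in(0,2]$, and $\kappa_\alpha(x,y)=|x-y|^{\alpha-n}$ is the Riesz kernel on $\mathbb R^n$. $\mathfrak M^+$ denotes the cone of positive Radon measures $\mu$ on $\mathbb R^n$ whose potential $\kappa_\alpha\mu(x)=\int|x-z|^{\alpha-n}d\mu(z)$ is not identically $+\infty$. The energy of $\mu$ is $\|\mu\|_\alpha^2=\iint\kappa_\alpha\,d\mu\,d\mu$; $\mathcal E^+_\alpha(A)$ is the set of positive measures of finite energy concentrated on $A$. The inner capacity of $A\subset\mathbb R^n$ is defined by $1/c_\alpha(A)=\inf\{\|\mu\|_\alpha^2:\ \mu\in\mathcal E^+_\alpha(A),\ \mu(\mathbb R^n)=1\}$. "n.e. on $A$" means: for all points of $A$ except a subset of inner capacity zero. Inner balayage: for $\mu\in\mathfrak M^+$ and arbitrary $A$, $\mu^A$ is the unique measure in $\mathfrak M^+$ with $\kappa_\alpha\mu^A=\inf\{\kappa_\alpha\nu:\ \nu\in\mathfrak M^+,\ \kappa_\alpha\nu\ge\kappa_\alpha\mu \text{ n.e. on }A\}$ pointwise. $\varepsilon_y$ is the Dirac measure at $y$, $\varepsilon_y^A:=(\varepsilon_y)^A$, $A^r:=\{y:\ \varepsilon_y^A=\varepsilon_y\}$. *)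

theory Defs
  imports "HOL-Analysis.Analysis" "HOL-Probability.Giry_Monad"
begin

definition riesz_kernel :: "real \<Rightarrow> 'a::euclidean_space \<Rightarrow> 'a \<Rightarrow> ennreal" where
  "riesz_kernel \<alpha> x y = (if x = y then \<infinity> else ennreal (dist x y powr (\<alpha> - real DIM('a))))"

definition radon_pos :: "'a::euclidean_space measure \<Rightarrow> bool" where
  "radon_pos \<mu> \<longleftrightarrow> sets \<mu> = sets borel \<and> (\<forall>K. compact K \<longrightarrow> emeasure \<mu> K < \<infinity>)"

definition potential :: "real \<Rightarrow> 'a::euclidean_space measure \<Rightarrow> 'a \<Rightarrow> ennreal" where
  "potential \<alpha> \<mu> x = (\<integral>\<^sup>+ z. riesz_kernel \<alpha> x z \<partial>\<mu>)"

definition Mplus :: "real \<Rightarrow> 'a::euclidean_space measure set" where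
  "Mplus \<alpha> = {\<mu>. radon_pos \<mu> \<and> (\<exists>x. potential \<alpha> \<mu> x < \<infinity>)}"

definition energy :: "real \<Rightarrow> 'a::euclidean_space measure \<Rightarrow> ennreal" where
  "energy \<alpha> \<mu> = (\<integral>\<^sup>+ x. potential \<alpha> \<mu> x \<partial>\<mu>)"

text \<open>mu is concentrated on an arbitrary set A: the complement of A is mu-negligible.\<close>
definition concentrated_on :: "'a::euclidean_space measure \<Rightarrow> 'a set \<Rightarrow> bool" where
  "concentrated_on \<mu> A \<longleftrightarrow> (\<exists>B \<in> sets borel. B \<subseteq> A \<and> emeasure \<mu> (UNIV - B) = 0)"

definition Eplus :: "real \<Rightarrow> 'a::euclidean_space set \<Rightarrow> 'a measure set" where
  "Eplus \<alpha> A = {\<mu>. radon_pos \<mu> \<and> energy \<alpha> \<mu> < \<infinity> \<and> concentrated_on \<mu> A}"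

text \<open>Inner capacity: 1/c(A) = inf of energies of unit measures in E^+(A) (inf of empty set = infinity).\<close>
definition inner_cap :: "real \<Rightarrow> 'a::euclidean_space set \<Rightarrow> ennreal" where
  "inner_cap \<alpha> A = inverse (INF \<mu> \<in> {\<mu> \<in> Eplus \<alpha> A. emeasure \<mu> UNIV = 1}. energy \<alpha> \<mu>)"

definition nearly_everywhere :: "real \<Rightarrow> 'a::euclidean_space set \<Rightarrow> ('a \<Rightarrow> bool) \<Rightarrow> bool" where
  "nearly_everywhere \<alpha> A P \<longleftrightarrow> (\<exists>E \<subseteq> A. inner_cap \<alpha> E = 0 \<and> (\<forall>x \<in> A - E. P x))"

definition is_balayage :: "real \<Rightarrow> 'a::euclidean_space measure \<Rightarrow> 'a set \<Rightarrow> 'a measure \<Rightarrow> bool" where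
  "is_balayage \<alpha> \<mu> A \<nu> \<longleftrightarrow> \<nu> \<in> Mplus \<alpha> \<and>
     (\<forall>x. potential \<alpha> \<nu> x =
        (INF \<nu>' \<in> {\<nu>' \<in> Mplus \<alpha>. nearly_everywhere \<alpha> A (\<lambda>y. potential \<alpha> \<mu> y \<le> potential \<alpha> \<nu>' y)}.
           potential \<alpha> \<nu>' x))"

definition balayage :: "real \<Rightarrow> 'a::euclidean_space measure \<Rightarrow> 'a set \<Rightarrow> 'a measure" where
  "balayage \<alpha> \<mu> A = (THE \<nu>. is_balayage \<alpha> \<mu> A \<nu>)"

definition regular_points :: "real \<Rightarrow> 'a::euclidean_space set \<Rightarrow> 'a set" where
  "regular_points \<alpha> A = {y. balayage \<alpha> (return borel y) A = return borel y}"

end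

theory Submission
  imports Defs
begin

text \<open>
  A measure of finite energy on \<open>A\<close> restricts, by Egorov and inner regularity, to a nonzero measure
  with compact support in \<open>A\<close> and continuous potential.  Continuous functions are separable for
  locally uniform convergence, so among the measures on \<open>A\<close> with compact support and continuous
  potential a countable family is dense in the sense of locally uniform convergence of potentials
  (with supports in a common ball); \<open>A0\<close> is the union of their supports.
  If the potential of \<open>\<nu>\<close> dominates that of \<open>\<mu>\<close> n.e. on \<open>A0\<close>, then, the potentials of the
  approximants being dominated by a multiple of \<open>riesz_kernel \<alpha> x0\<close>, Fubini and dominated
  convergence give \<open>\<integral> \<kappa>\<mu> d\<tau> \<le> \<integral> \<kappa>\<nu> d\<tau>\<close> for every \<open>\<tau>\<close> of this kind, hence domination n.e. on \<open>A\<close>.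
  So \<open>A\<close> and \<open>A0\<close> admit the same competitors in the definition of the balayage; its existence
  plays no role.
\<close>

section \<open>Riesz kernel, measurability of potentials, reciprocity\<close>

lemma riesz_kernel_commute: "riesz_kernel \<alpha> x y = riesz_kernel \<alpha> y x"
  by (simp add: riesz_kernel_def dist_commute)

lemma riesz_kernel_measurable [measurable]:
  fixes f g :: "'b \<Rightarrow> 'a::euclidean_space"
  assumes [measurable]: "f \<in> borel_measurable M" "g \<in> borel_measurable M"
  shows "(\<lambda>y. riesz_kernel \<alpha> (f y) (g y)) \<in> borel_measurable M"
  unfolding riesz_kernel_def by measurable

text \<open>The kernel is a decreasing power of the distance, so a distance bound up to a factor
  \<open>c\<close> turns into a kernel bound up to \<open>c powr (real DIM('a) - \<alpha>)\<close>.
  Kernels at different pairs of points are compared through this below.\<close>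

lemma riesz_kernel_le_scale:
  fixes x y u v :: "'a::euclidean_space"
  assumes "\<alpha> < real DIM('a)" "0 < c" "dist u v \<le> c * dist x y"
  shows "riesz_kernel \<alpha> x y \<le> ennreal (c powr (real DIM('a) - \<alpha>)) * riesz_kernel \<alpha> u v"
proof (cases "u = v")
  case True
  then show ?thesis using assms by (simp add: riesz_kernel_def ennreal_mult_top)
next
  case False
  then have "x \<noteq> y" using assms by auto
  have "dist x y powr (\<alpha> - real DIM('a)) = c powr (real DIM('a) - \<alpha>) * (c * dist x y) powr (\<alpha> - real DIM('a))"
    using assms(2) by (simp add: powr_mult powr_add[symmetric] mult.assoc[symmetric])
  also have "\<dots> \<le> c powr (real DIM('a) - \<alpha>) * dist u v powr (\<alpha> - real DIM('a))"
    using False assms by (intro mult_left_mono powr_mono2') auto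
  finally show ?thesis
    using False \<open>x \<noteq> y\<close> by (simp add: riesz_kernel_def ennreal_mult[symmetric])
qed

lemma space_radon_pos: "radon_pos \<mu> \<Longrightarrow> space \<mu> = UNIV"
  using sets_eq_imp_space_eq[of \<mu> borel] by (auto simp: radon_pos_def)

lemma sigma_finite_radon_pos:
  assumes "radon_pos \<mu>"
  shows "sigma_finite_measure \<mu>"
proof
  have "space \<mu> = UNIV" using assms by (rule space_radon_pos)
  moreover have "(\<Union>i::nat. cball 0 (real i)) = (UNIV :: 'a set)"
    by (auto simp: real_arch_simple)
  ultimately show "\<exists>A. countable A \<and> A \<subseteq> sets \<mu> \<and> \<Union> A = space \<mu> \<and> (\<forall>a\<in>A. emeasure \<mu> a \<noteq> \<infinity>)"
    using assms
    by (intro exI[of _ "range (\<lambda>i::nat. cball 0 (real i))"])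
       (auto simp: radon_pos_def less_top)
qed

lemma potential_measurable [measurable]:
  assumes "radon_pos \<mu>"
  shows "potential \<alpha> \<mu> \<in> borel_measurable borel"
proof -
  interpret sigma_finite_measure \<mu> using assms by (rule sigma_finite_radon_pos)
  have [measurable_cong]: "sets \<mu> = sets borel" using assms by (simp add: radon_pos_def)
  show ?thesis unfolding potential_def by measurable
qed

text \<open>Tonelli and the symmetry of the kernel. An inequality of potentials tested against a
  measure thereby becomes a statement about the potential of the test measure, which is the function
  being approximated later.\<close>

lemma nn_integral_potential_commute:
  assumes \<mu>: "radon_pos \<mu>" and \<nu>: "radon_pos \<nu>"
  shows "(\<integral>\<^sup>+x. potential \<alpha> \<mu> x \<partial>\<nu>) = (\<integral>\<^sup>+x. potential \<alpha> \<nu> x \<partial>\<mu>)"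
proof -
  interpret M: sigma_finite_measure \<mu> using \<mu> by (rule sigma_finite_radon_pos)
  interpret N: sigma_finite_measure \<nu> using \<nu> by (rule sigma_finite_radon_pos)
  interpret pair_sigma_finite \<nu> \<mu> ..
  have [measurable_cong]: "sets \<mu> = sets borel" "sets \<nu> = sets borel"
    using \<mu> \<nu> by (simp_all add: radon_pos_def)
  have "(\<lambda>(x, z). riesz_kernel \<alpha> x z) \<in> borel_measurable (\<nu> \<Otimes>\<^sub>M \<mu>)" by measurable
  from Fubini'[OF this] show ?thesis
    unfolding potential_def by (simp add: riesz_kernel_commute)
qed

section \<open>Egorov's theorem and countable locally uniform density\<close>

text \<open>For fixed \<open>i\<close> the sets where \<open>g m\<close> exceeds
  \<open>1 / Suc i\<close> decrease to a null set, so by finiteness of the measure their mass tends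
  to 0. Discarding one such set for each \<open>i\<close> costs a geometric series in total.\<close>

lemma egorov_decseq_ennreal:
  fixes g :: "nat \<Rightarrow> 'b \<Rightarrow> ennreal"
  assumes "finite_measure M" and [measurable]: "\<And>m. g m \<in> borel_measurable M"
    and dec: "\<And>x. decseq (\<lambda>m. g m x)" and lim: "AE x in M. (INF m. g m x) = 0"
    and e: "0 < e"
  obtains G where "G \<in> sets M" "emeasure M (space M - G) < e"
    "\<And>i. \<exists>m. \<forall>x\<in>G. g m x \<le> ennreal (1 / Suc i)"
proof -
  interpret finite_measure M by fact
  \<comment> \<open>\<open>e\<close> may be infinite. A real \<open>r\<close> strictly below it
    leaves room for the final strict inequality, because the discarded masses sum to at most
    \<open>r\<close>.\<close>
  obtain r where r: "0 < r" "ennreal r < e"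
  proof -
    obtain z where z: "0 < z" "z < e" using dense[OF e] by blast
    then have "z < top" by (simp add: less_le_trans)
    with z show thesis by (intro that[of "enn2real z"]) (auto simp: enn2real_positive_iff)
  qed
  define N where "N i m = {x\<in>space M. ennreal (1 / Suc i) < g m x}" for i m
  have [measurable]: "N i m \<in> sets M" for i m unfolding N_def by measurable
  have "\<exists>m. emeasure M (N i m) < ennreal (r * (1/2) ^ Suc i)" for i
  proof -
    have "decseq (N i)"
      using dec unfolding N_def decseq_def by (force intro: less_le_trans)
    then have "(\<lambda>m. emeasure M (N i m)) \<longlonglongrightarrow> emeasure M (\<Inter>m. N i m)"
      by (intro Lim_emeasure_decseq) auto
    also have "emeasure M (\<Inter>m. N i m) = 0"
    proof -
      have "AE x in M. x \<notin> (\<Inter>m. N i m)"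
        using lim
      proof eventually_elim
        case (elim x)
        show ?case
        proof
          assume "x \<in> (\<Inter>m. N i m)"
          then have "ennreal (1 / Suc i) \<le> (INF m. g m x)"
            by (intro INF_greatest) (auto simp: N_def less_imp_le)
          with elim show False by simp
        qed
      qed
      moreover have "(\<Inter>m. N i m) = {x \<in> space M. \<not> x \<notin> (\<Inter>m. N i m)}"
        by (auto simp: N_def)
      ultimately show ?thesis by (subst (asm) AE_iff_measurable[of "\<Inter>m. N i m"]) auto
    qed
    finally have "eventually (\<lambda>m. emeasure M (N i m) < ennreal (r * (1/2) ^ Suc i)) sequentially"
      using r by (intro order_tendstoD) auto
    then show ?thesis by (auto simp: eventually_sequentially)
  qed
  then obtain m where m: "\<And>i. emeasure M (N i (m i)) < ennreal (r * (1/2) ^ Suc i)" by metis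
  define G where "G = space M - (\<Union>i. N i (m i))"
  show thesis
  proof
    show "G \<in> sets M" unfolding G_def by measurable
    have "space M - G = (\<Union>i. N i (m i))" by (auto simp: G_def N_def)
    also have "emeasure M \<dots> \<le> (\<Sum>i. emeasure M (N i (m i)))"
      by (rule emeasure_subadditive_countably) auto
    also have "\<dots> \<le> (\<Sum>i. ennreal (r * (1/2) ^ Suc i))"
      using m by (intro suminf_le) (auto intro: less_imp_le)
    also have "\<dots> = ennreal r"
      using sums_mult[OF power_half_series, of r] r by (intro suminf_ennreal_eq) auto
    finally show "emeasure M (space M - G) < e" using r by auto
    show "\<exists>m. \<forall>x\<in>G. g m x \<le> ennreal (1 / Suc i)" for i
      by (rule exI[of _ "m i"]) (auto simp: G_def N_def not_less)
  qed
qed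

text \<open>Each function is described on a ball, up to a tolerance, by a finite code taken from a
  countable set. Selecting one member of \<open>S\<close> for each code that occurs suffices, since
  two functions with a common code are close on the ball.\<close>

lemma countable_locally_uniformly_dense:
  fixes F :: "'s \<Rightarrow> 'a::euclidean_space \<Rightarrow> real"
  assumes cont: "\<And>s. s \<in> S \<Longrightarrow> continuous_on UNIV (F s)"
  obtains D where "countable D" "D \<subseteq> S"
    "\<forall>s\<in>S. \<forall>k. \<exists>t\<in>D. \<forall>x\<in>cball 0 (real k). \<bar>F t x - F s x\<bar> < 1 / Suc k"
proof -
  obtain \<B> :: "'a set set" where \<B>: "countable \<B>" "topological_basis \<B>"
    using ex_countable_basis by blast
  define C where "C = {c. finite c \<and> c \<subseteq> \<B> \<times> (\<rat> :: real set)}"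
  have "countable C"
    unfolding C_def using \<B> by (intro countable_Collect_finite_subset countable_SIGMA countable_rat)
  \<comment> \<open>A code covers the ball by finitely many basic open sets, each paired with a
    rational within half the tolerance of all values of \<open>F s\<close> there. The two halves add
    up to \<open>1 / Suc k\<close>.\<close>
  define approx where "approx s k c \<longleftrightarrow> s \<in> S \<and> cball 0 (real k) \<subseteq> (\<Union>p\<in>c. fst p) \<and>
     (\<forall>p\<in>c. \<forall>x\<in>fst p. \<bar>F s x - snd p\<bar> < 1 / (2 * Suc k))" for s k c
  have ex: "\<exists>c\<in>C. approx s k c" if s: "s \<in> S" for s k
  proof -
    define P where "P = {p\<in>\<B> \<times> \<rat>. \<forall>x\<in>fst p. \<bar>F s x - snd p\<bar> < 1 / (2 * Suc k)}"
    have "\<exists>p\<in>P. x \<in> fst p" for x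
    proof -
      obtain q where q: "q \<in> \<rat>" "F s x < q" "q < F s x + 1 / (2 * Suc k)"
        using Rats_dense_in_real[of "F s x" "F s x + 1 / (2 * Suc k)"] by auto
      have "open (F s -` ball q (1 / (2 * Suc k)))"
        using cont[OF s] by (intro open_vimage) auto
      moreover have "x \<in> F s -` ball q (1 / (2 * Suc k))"
        using q by (auto simp: dist_real_def)
      ultimately obtain U where "U \<in> \<B>" "x \<in> U" "U \<subseteq> F s -` ball q (1 / (2 * Suc k))"
        using \<B>(2) by (meson topological_basisE)
      then show ?thesis using q
        by (intro bexI[of _ "(U, q)"]) (auto simp: P_def dist_real_def abs_minus_commute)
    qed
    then have "cball 0 (real k) \<subseteq> (\<Union>p\<in>P. fst p)" by blast
    moreover have "\<And>p. p \<in> P \<Longrightarrow> open (fst p)"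
      using topological_basis_open[OF \<B>(2)] by (auto simp: P_def)
    ultimately obtain c where "c \<subseteq> P" "finite c" "cball 0 (real k) \<subseteq> (\<Union>p\<in>c. fst p)"
      using compactE_image[OF compact_cball, of P fst 0 "real k"] by metis
    then show ?thesis using s by (intro bexI[of _ c]) (auto simp: C_def approx_def P_def)
  qed
  \<comment> \<open>Only codes that occur are kept, so \<open>SOME\<close> has a witness and every
    selected function belongs to \<open>S\<close>.\<close>
  define J where "J = {(k, c). c \<in> C \<and> (\<exists>s. approx s k c)}"
  define pick where "pick j = (SOME s. approx s (fst j) (snd j))" for j
  have pick: "approx (pick j) (fst j) (snd j)" if "j \<in> J" for j
    using that unfolding pick_def J_def by (auto intro: someI)
  show thesis
  proof
    have "J \<subseteq> UNIV \<times> C" by (auto simp: J_def)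
    moreover have "countable ((UNIV :: nat set) \<times> C)" using \<open>countable C\<close> by simp
    ultimately have "countable J" by (rule countable_subset)
    then show "countable (pick ` J)" by simp
    show "pick ` J \<subseteq> S" using pick by (auto simp: approx_def)
    show "\<forall>s\<in>S. \<forall>k. \<exists>t\<in>pick ` J. \<forall>x\<in>cball 0 (real k). \<bar>F t x - F s x\<bar> < 1 / Suc k"
    proof (intro ballI allI)
      fix s k assume "s \<in> S"
      then obtain c where c: "c \<in> C" "approx s k c" using ex by blast
      then have "(k, c) \<in> J" by (auto simp: J_def)
      with pick have p: "approx (pick (k, c)) k c" by fastforce
      have "\<bar>F (pick (k, c)) x - F s x\<bar> < 1 / Suc k" if x: "x \<in> cball 0 (real k)" for x
      proof -
        obtain q where "q \<in> c" "x \<in> fst q" using x c(2) unfolding approx_def by blast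
        define h where "h = 1 / real (2 * Suc k)"
        from \<open>q \<in> c\<close> \<open>x \<in> fst q\<close> p c(2)
        have "\<bar>F (pick (k, c)) x - snd q\<bar> < h" "\<bar>F s x - snd q\<bar> < h"
          unfolding approx_def h_def by blast+
        moreover have "1 / real (Suc k) = h + h"
          by (simp add: h_def field_simps)
        ultimately show ?thesis by linarith
      qed
      with \<open>(k, c) \<in> J\<close> show "\<exists>t\<in>pick ` J. \<forall>x\<in>cball 0 (real k). \<bar>F t x - F s x\<bar> < 1 / Suc k" by blast
    qed
  qed
qed

section \<open>Truncated kernels and a continuity criterion for potentials\<close>

lemma nn_integral_density_indicator_le:
  assumes "K \<in> sets M" "f \<in> borel_measurable M"
  shows "(\<integral>\<^sup>+y. f y \<partial>density M (indicator K)) \<le> (\<integral>\<^sup>+y. f y \<partial>M)"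
  using assms by (auto simp: nn_integral_density indicator_def intro!: nn_integral_mono)

text \<open>The singular part of the kernel. For \<open>\<alpha> < real DIM('a)\<close> and
  \<open>0 < d\<close> the remaining part is bounded, so continuity of a potential reduces to
  uniform smallness of the integral of this part.\<close>

definition near_kernel :: "real \<Rightarrow> real \<Rightarrow> 'a::euclidean_space \<Rightarrow> 'a \<Rightarrow> ennreal" where
  "near_kernel \<alpha> d x y = (if dist x y < d then riesz_kernel \<alpha> x y else 0)"

lemma near_kernel_measurable [measurable]:
  fixes f g :: "'b \<Rightarrow> 'a::euclidean_space"
  assumes [measurable]: "f \<in> borel_measurable M" "g \<in> borel_measurable M"
  shows "(\<lambda>y. near_kernel \<alpha> d (f y) (g y)) \<in> borel_measurable M"
  unfolding near_kernel_def by measurable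

text \<open>A finite potential at \<open>x\<close> excludes mass at \<open>x\<close>, where the
  kernel is infinite. Hence the truncated kernels decrease to 0 almost everywhere, and the first of
  them already has a finite integral, so infimum and integral may be exchanged.\<close>

lemma INF_near_potential_eq_0:
  fixes x :: "'a::euclidean_space"
  assumes [measurable_cong]: "sets M = sets borel" and fin: "potential \<alpha> M x < \<infinity>"
  shows "(INF m. \<integral>\<^sup>+y. near_kernel \<alpha> (1 / Suc m) x y \<partial>M) = 0"
proof -
  have dec: "decseq (\<lambda>m y. near_kernel \<alpha> (1 / Suc m) x y)"
    unfolding monotone_def le_fun_def
  proof (intro allI impI)
    fix m n :: nat and y assume "m \<le> n"
    then have "1 / real (Suc n) \<le> 1 / real (Suc m)" by (simp add: frac_le)
    then show "near_kernel \<alpha> (1 / Suc n) x y \<le> near_kernel \<alpha> (1 / Suc m) x y"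
      by (auto simp: near_kernel_def)
  qed
  have "(\<integral>\<^sup>+y. near_kernel \<alpha> (1 / Suc 0) x y \<partial>M) \<le> potential \<alpha> M x"
    unfolding potential_def by (intro nn_integral_mono) (auto simp: near_kernel_def)
  then have "(INF m. \<integral>\<^sup>+y. near_kernel \<alpha> (1 / Suc m) x y \<partial>M) =
      (\<integral>\<^sup>+y. (INF m. near_kernel \<alpha> (1 / Suc m) x y) \<partial>M)"
    using fin by (intro nn_integral_monotone_convergence_INF_decseq[symmetric, OF dec, of _ 0]) auto
  also have "\<dots> = 0"
  proof -
    have "AE y in M. riesz_kernel \<alpha> x y \<noteq> \<infinity>"
      using fin unfolding potential_def by (intro nn_integral_PInf_AE) auto
    then have "AE y in M. (INF m. near_kernel \<alpha> (1 / Suc m) x y) = 0"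
    proof eventually_elim
      case (elim y)
      then have "x \<noteq> y" by (auto simp: riesz_kernel_def)
      then obtain m where "inverse (real (Suc m)) < dist x y" using reals_Archimedean[of "dist x y"] by auto
      then have "near_kernel \<alpha> (1 / Suc m) x y = 0"
        by (auto simp: near_kernel_def inverse_eq_divide)
      then show ?case by (metis (no_types, lifting) INF_lower UNIV_I le_zero_eq)
    qed
    then show ?thesis by (subst nn_integral_0_iff_AE) auto
  qed
  finally show ?thesis .
qed

text \<open>Points off \<open>K\<close> are handled by passing to a nearest point of \<open>K\<close>, which at most doubles
  distances to the points of \<open>K\<close>.\<close>

lemma near_potential_uniformly_small:
  fixes M :: "'a::euclidean_space measure"
  assumes \<alpha>: "\<alpha> < real DIM('a)" and sets: "sets M = sets borel"
    and K: "compact K" "emeasure M (- K) = 0"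
    and small: "\<And>e. 0 < e \<Longrightarrow> \<exists>d>0. \<forall>x\<in>K. (\<integral>\<^sup>+y. near_kernel \<alpha> d x y \<partial>M) \<le> ennreal e"
    and e: "0 < e"
  shows "\<exists>d>0. \<forall>x. (\<integral>\<^sup>+y. near_kernel \<alpha> d x y \<partial>M) \<le> ennreal e"
proof -
  note [measurable_cong] = sets
  have AEK: "AE y in M. y \<in> K"
  proof (rule AE_I)
    show "- K \<in> sets M" using compact_imp_closed[OF K(1)] sets by simp
  qed (use K in auto)
  show ?thesis
  proof (cases "K = {}")
    case True
    have "(\<integral>\<^sup>+y. near_kernel \<alpha> 1 x y \<partial>M) = 0" for x
      using True AEK by (subst nn_integral_0_iff_AE) auto
    then show ?thesis by (intro exI[of _ 1]) auto
  next
    case False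
    \<comment> \<open>The kernel factor for doubled distances: the bound \<open>e / c\<close> at
      points of \<open>K\<close> yields \<open>e\<close> everywhere, with the radius halved.\<close>
    define c where "c = 2 powr (real DIM('a) - \<alpha>)"
    have c: "0 < c" by (simp add: c_def)
    obtain d where d: "0 < d" "\<And>x. x \<in> K \<Longrightarrow> (\<integral>\<^sup>+y. near_kernel \<alpha> d x y \<partial>M) \<le> ennreal (e / c)"
      using small[of "e / c"] e c by auto
    have "(\<integral>\<^sup>+y. near_kernel \<alpha> (d / 2) x y \<partial>M) \<le> ennreal e" for x
    proof -
      obtain u where u: "u \<in> K" "\<And>y. y \<in> K \<Longrightarrow> dist x u \<le> dist x y"
        using distance_attains_inf[of K x] K False compact_imp_closed by blast
      have "(\<integral>\<^sup>+y. near_kernel \<alpha> (d / 2) x y \<partial>M)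
         \<le> (\<integral>\<^sup>+y. ennreal c * near_kernel \<alpha> d u y \<partial>M)"
      proof (intro nn_integral_mono_AE, use AEK in eventually_elim)
        case (elim y)
        have "dist u y \<le> dist x u + dist x y" by (metis dist_commute dist_triangle)
        then have le: "dist u y \<le> 2 * dist x y" using u(2)[OF elim] by simp
        then show ?case
          using riesz_kernel_le_scale[OF \<alpha> _ le] by (auto simp: near_kernel_def c_def)
      qed
      also have "\<dots> = ennreal c * (\<integral>\<^sup>+y. near_kernel \<alpha> d u y \<partial>M)"
        by (rule nn_integral_cmult) measurable
      also have "\<dots> \<le> ennreal c * ennreal (e / c)" by (intro mult_left_mono d u) auto
      also have "\<dots> = ennreal e" using c e by (simp add: ennreal_mult[symmetric])
      finally show ?thesis .
    qed
    with d(1) show ?thesis by (intro exI[of _ "d / 2"]) auto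
  qed
qed

text \<open>Truncating the kernel near the diagonal gives continuous functions \<open>f d\<close>.
  The potential exceeds \<open>f d\<close> by at most the near part, which is uniformly small, so it
  is a uniform limit of continuous functions.\<close>

lemma continuous_potential:
  fixes M :: "'a::euclidean_space measure"
  assumes \<alpha>: "\<alpha> < real DIM('a)" and sets: "sets M = sets borel" and fin: "finite_measure M"
    and small: "\<And>e. 0 < e \<Longrightarrow> \<exists>d>0. \<forall>x. (\<integral>\<^sup>+y. near_kernel \<alpha> d x y \<partial>M) \<le> ennreal e"
  shows "potential \<alpha> M x < \<infinity>" and "continuous_on UNIV (\<lambda>x. enn2real (potential \<alpha> M x))"
proof -
  interpret finite_measure M by fact
  note [measurable_cong] = sets
  \<comment> \<open>Capping the distance from below by \<open>d\<close> makes the kernel bounded and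
    continuous. It stays below the Riesz kernel and agrees with it at distances of at least
    \<open>d\<close>.\<close>
  define k where "k d x y = max (dist x y) d powr (\<alpha> - real DIM('a))" for d and x y :: 'a
  define f where "f d x = (\<integral>y. k d x y \<partial>M)" for d x
  have bound: "\<bar>k d x y\<bar> \<le> d powr (\<alpha> - real DIM('a))" if "0 < d" for d x y
    using that \<alpha> unfolding k_def by (auto intro!: powr_mono2')
  have [measurable]: "(\<lambda>y. k d x y) \<in> borel_measurable M" for d x
    unfolding k_def by measurable
  have int: "integrable M (\<lambda>y. k d x y)" if "0 < d" for d x
    by (rule integrable_const_bound[of _ "d powr (\<alpha> - real DIM('a))"]) (use bound[OF that] in auto)
  have nn: "(\<integral>\<^sup>+y. ennreal (k d x y) \<partial>M) = ennreal (f d x)" if "0 < d" for d x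
    unfolding f_def by (intro nn_integral_eq_integral int that) (auto simp: k_def)
  have f_nonneg: "0 \<le> f d x" for d x unfolding f_def by (intro integral_nonneg_AE) (auto simp: k_def)
  have contf: "continuous_on UNIV (f d)" if "0 < d" for d
    unfolding continuous_on_sequentially
  proof (intro ballI allI impI, elim conjE)
    fix X :: "nat \<Rightarrow> 'a" and a assume X: "X \<longlonglongrightarrow> a"
    have "(\<lambda>n. \<integral>y. k d (X n) y \<partial>M) \<longlonglongrightarrow> (\<integral>y. k d a y \<partial>M)"
    proof (rule integral_dominated_convergence)
      show "AE y in M. (\<lambda>n. k d (X n) y) \<longlonglongrightarrow> k d a y"
        unfolding k_def using X that by (intro AE_I2 tendsto_intros) auto
    qed (use bound[OF that] in auto)
    then show "(f d \<circ> X) \<longlonglongrightarrow> f d a" by (simp add: f_def comp_def)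
  qed
  have lower: "ennreal (f d x) \<le> potential \<alpha> M x" if "0 < d" for d x
    unfolding nn[OF that, symmetric] potential_def
    using \<alpha> by (intro nn_integral_mono) (auto simp: riesz_kernel_def k_def intro!: ennreal_leI powr_mono2')
  have upper: "potential \<alpha> M x \<le> ennreal (f d x) + (\<integral>\<^sup>+y. near_kernel \<alpha> d x y \<partial>M)"
    if "0 < d" for d x
  proof -
    have "potential \<alpha> M x \<le> (\<integral>\<^sup>+y. ennreal (k d x y) + near_kernel \<alpha> d x y \<partial>M)"
      unfolding potential_def using that
      by (intro nn_integral_mono) (auto simp: riesz_kernel_def k_def near_kernel_def max_def)
    also have "\<dots> = ennreal (f d x) + (\<integral>\<^sup>+y. near_kernel \<alpha> d x y \<partial>M)"
      by (subst nn_integral_add) (auto simp: nn[OF that])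
    finally show ?thesis .
  qed
  show finp: "potential \<alpha> M x < \<infinity>" for x
  proof -
    obtain d where d: "0 < d" "(\<integral>\<^sup>+y. near_kernel \<alpha> d x y \<partial>M) \<le> ennreal 1"
      using small[of 1] by auto
    show ?thesis using upper[OF d(1), of x] d(2)
      by (metis ennreal_add_eq_top ennreal_less_top infinity_ennreal_def le_less_trans less_top)
  qed
  obtain d where d: "\<And>n. 0 < d n"
    "\<And>n x. (\<integral>\<^sup>+y. near_kernel \<alpha> (d n) x y \<partial>M) \<le> ennreal (1 / Suc n)"
  proof -
    have "\<forall>n::nat. \<exists>d>0. \<forall>x. (\<integral>\<^sup>+y. near_kernel \<alpha> d x y \<partial>M) \<le> ennreal (1 / Suc n)"
      by (intro allI small) simp
    from choice[OF this] show thesis using that by blast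
  qed
  have close: "\<bar>enn2real (potential \<alpha> M x) - f (d n) x\<bar> \<le> 1 / Suc n" for n x
  proof -
    have "potential \<alpha> M x = ennreal (enn2real (potential \<alpha> M x))" using finp[of x] by simp
    moreover have "potential \<alpha> M x \<le> ennreal (f (d n) x) + ennreal (1 / Suc n)"
      using upper[OF d(1)[of n], of x] d(2)[where n=n and x=x] by (meson add_left_mono order_trans)
    ultimately have "ennreal (enn2real (potential \<alpha> M x)) \<le> ennreal (f (d n) x + 1 / Suc n)"
      using f_nonneg by (simp add: ennreal_plus)
    then have "enn2real (potential \<alpha> M x) \<le> f (d n) x + 1 / Suc n"
      using f_nonneg[of "d n" x] by (subst (asm) ennreal_le_iff) auto
    moreover have "f (d n) x \<le> enn2real (potential \<alpha> M x)"
      using enn2real_mono[OF lower[OF d(1)[of n], of x]] finp[of x] f_nonneg by auto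
    moreover have "0 \<le> 1 / real (Suc n)" by simp
    ultimately show ?thesis by linarith
  qed
  have "uniform_limit UNIV (\<lambda>n. f (d n)) (\<lambda>x. enn2real (potential \<alpha> M x)) sequentially"
  proof (rule uniform_limitI)
    fix e :: real assume "0 < e"
    then have "eventually (\<lambda>n. 1 / real (Suc n) < e) sequentially"
      using LIMSEQ_inverse_real_of_nat by (auto simp: inverse_eq_divide dest: order_tendstoD)
    then show "eventually (\<lambda>n. \<forall>x\<in>UNIV. dist (f (d n) x) (enn2real (potential \<alpha> M x)) < e) sequentially"
    proof eventually_elim
      case (elim n)
      then show ?case using close[of _ n] by (auto simp: dist_real_def abs_minus_commute intro: le_less_trans)
    qed
  qed
  then show "continuous_on UNIV (\<lambda>x. enn2real (potential \<alpha> M x))"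
    by (rule uniform_limit_theorem[rotated]) (auto simp: contf d(1))
qed

section \<open>Restrictions of finite-energy measures with continuous potential\<close>

lemma potential_density_indicator_le:
  assumes "radon_pos \<mu>" "K \<in> sets borel"
  shows "potential \<alpha> (density \<mu> (indicator K)) x \<le> potential \<alpha> \<mu> x"
proof -
  have [measurable_cong]: "sets \<mu> = sets borel" using assms by (simp add: radon_pos_def)
  have "(\<lambda>y. riesz_kernel \<alpha> x y) \<in> borel_measurable \<mu>" by measurable
  then show ?thesis unfolding potential_def using assms
    by (intro nn_integral_density_indicator_le) (auto simp: radon_pos_def)
qed

lemma energy_density_indicator_le:
  assumes "radon_pos \<mu>" "K \<in> sets borel"
  shows "energy \<alpha> (density \<mu> (indicator K)) \<le> energy \<alpha> \<mu>"
proof -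
  have [measurable_cong]: "sets \<mu> = sets borel" using assms by (simp add: radon_pos_def)
  have "energy \<alpha> (density \<mu> (indicator K)) \<le> (\<integral>\<^sup>+x. potential \<alpha> \<mu> x \<partial>density \<mu> (indicator K))"
    unfolding energy_def by (intro nn_integral_mono potential_density_indicator_le assms)
  also have "\<dots> \<le> energy \<alpha> \<mu>"
    unfolding energy_def using assms potential_measurable[OF assms(1)]
    by (intro nn_integral_density_indicator_le) auto
  finally show ?thesis .
qed

text \<open>The compact carrier \<open>K\<close> is stored with the measure because the carriers of
  a countable family will make up the K_sigma set; it need not be the support. The common radius
  \<open>R\<close> makes the later domination uniform over the family. Finiteness is demanded
  separately because \<open>enn2real\<close> sends infinity to 0.\<close>

definition cont_pot_measures :: "real \<Rightarrow> 'a::euclidean_space set \<Rightarrow> real \<Rightarrow> ('a measure \<times> 'a set) set" where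
  "cont_pot_measures \<alpha> A R = {(\<tau>, K). compact K \<and> K \<subseteq> A \<inter> cball 0 R \<and> radon_pos \<tau> \<and>
     emeasure \<tau> (- K) = 0 \<and> energy \<alpha> \<tau> < \<infinity> \<and> (\<forall>x. potential \<alpha> \<tau> x < \<infinity>) \<and>
     continuous_on UNIV (\<lambda>x. enn2real (potential \<alpha> \<tau> x))}"

text \<open>Finite energy makes the potential finite almost everywhere, so the near potentials tend
  to 0 almost everywhere, and by Egorov uniformly on a large set. Inner regularity supplies a
  compact \<open>K\<close> inside it, and restricting the measure only decreases near potentials.
  \<open>A\<close> and \<open>R\<close> stay free in the conclusion because a radius for
  \<open>K\<close> is known only afterwards.\<close>

lemma exists_cont_pot_restriction:
  fixes \<sigma> :: "'a::euclidean_space measure"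
  assumes \<alpha>: "\<alpha> < real DIM('a)" and rad: "radon_pos \<sigma>" and en: "energy \<alpha> \<sigma> < \<infinity>"
    and mass: "emeasure \<sigma> UNIV = 1"
    and B: "B \<in> sets borel" "emeasure \<sigma> (UNIV - B) = 0"
  obtains K where "compact K" "K \<subseteq> B" "0 < emeasure \<sigma> K"
    "\<And>A R. K \<subseteq> A \<inter> cball 0 R \<Longrightarrow> (density \<sigma> (indicator K), K) \<in> cont_pot_measures \<alpha> A R"
proof -
  have sets [measurable_cong]: "sets \<sigma> = sets borel" using rad by (simp add: radon_pos_def)
  have sp: "space \<sigma> = UNIV" using rad by (rule space_radon_pos)
  interpret finite_measure \<sigma> by standard (simp add: sp mass)
  define g where "g m x = (\<integral>\<^sup>+y. near_kernel \<alpha> (1 / Suc m) x y \<partial>\<sigma>)" for m x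
  have "AE x in \<sigma>. potential \<alpha> \<sigma> x \<noteq> \<infinity>"
    using en potential_measurable[OF rad] unfolding energy_def
    by (intro nn_integral_PInf_AE) (auto cong: measurable_cong_sets)
  then have lim: "AE x in \<sigma>. (INF m. g m x) = 0"
    unfolding g_def by eventually_elim (rule INF_near_potential_eq_0[OF sets], simp add: less_top)
  have meas: "g m \<in> borel_measurable \<sigma>" for m unfolding g_def by measurable
  have dec: "decseq (\<lambda>m. g m x)" for x
    unfolding decseq_def g_def
  proof (intro allI impI nn_integral_mono)
    fix m n :: nat and y assume "m \<le> n"
    then have "1 / real (Suc n) \<le> 1 / real (Suc m)" by (simp add: frac_le)
    then show "near_kernel \<alpha> (1 / Suc n) x y \<le> near_kernel \<alpha> (1 / Suc m) x y"
      by (auto simp: near_kernel_def)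
  qed
  \<comment> \<open>The threshold 1 is the total mass, so what is lost outside \<open>G\<close>
    cannot exhaust \<open>B\<close>.\<close>
  obtain G where G: "G \<in> sets \<sigma>" "emeasure \<sigma> (space \<sigma> - G) < 1"
    "\<And>i. \<exists>m. \<forall>x\<in>G. g m x \<le> ennreal (1 / Suc i)"
    using egorov_decseq_ennreal[OF finite_measure_axioms meas dec lim, of 1] by auto
  have "0 < emeasure \<sigma> (B \<inter> G)"
  proof (rule ccontr)
    assume "\<not> 0 < emeasure \<sigma> (B \<inter> G)"
    then have "emeasure \<sigma> (B \<inter> G) = 0" by simp
    have BG: "B \<in> sets \<sigma>" "G \<in> sets \<sigma>" using B G sets by auto
    have "(B \<inter> G) \<union> ((UNIV - B) \<union> (space \<sigma> - G)) = UNIV" by (auto simp: sp)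
    then have "1 = emeasure \<sigma> ((B \<inter> G) \<union> ((UNIV - B) \<union> (space \<sigma> - G)))" by (simp only: mass)
    also have "\<dots> \<le> emeasure \<sigma> (B \<inter> G) + emeasure \<sigma> ((UNIV - B) \<union> (space \<sigma> - G))"
      using BG by (intro emeasure_subadditive) (auto simp: sp[symmetric])
    also have "\<dots> \<le> emeasure \<sigma> (B \<inter> G) + (emeasure \<sigma> (UNIV - B) + emeasure \<sigma> (space \<sigma> - G))"
      using BG by (intro add_left_mono emeasure_subadditive) (auto simp: sp[symmetric])
    also have "\<dots> < 1" using \<open>emeasure \<sigma> (B \<inter> G) = 0\<close> B G by simp
    finally show False by simp
  qed
  also have "emeasure \<sigma> (B \<inter> G) = (SUP K \<in> {K. K \<subseteq> B \<inter> G \<and> compact K}. emeasure \<sigma> K)"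
    using B G sets by (intro inner_regular) (auto simp: sp mass)
  finally obtain K where K: "K \<subseteq> B" "K \<subseteq> G" "compact K" "0 < emeasure \<sigma> K"
    by (auto simp: less_SUP_iff)
  have Kb: "K \<in> sets borel" using K by (simp add: borel_compact)
  define \<tau> where "\<tau> = density \<sigma> (indicator K)"
  have \<tau>sets: "sets \<tau> = sets borel" by (simp add: \<tau>_def sets)
  have \<tau>em: "emeasure \<tau> X = emeasure \<sigma> (K \<inter> X)" if "X \<in> sets borel" for X
    using that Kb unfolding \<tau>_def by (subst emeasure_density) (auto simp: sets mult.commute nn_integral_indicator indicator_inter_arith[symmetric])
  have \<tau>fin: "finite_measure \<tau>"
    by (rule finite_measureI) (use \<tau>em[of UNIV] sets_eq_imp_space_eq[OF \<tau>sets] in auto)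
  have \<tau>K: "emeasure \<tau> (- K) = 0" using Kb by (simp add: \<tau>em)
  have \<tau>rad: "radon_pos \<tau>"
    using \<tau>sets finite_measure.emeasure_finite[OF \<tau>fin] by (auto simp: radon_pos_def less_top)
  have small: "\<exists>d>0. \<forall>x\<in>K. (\<integral>\<^sup>+y. near_kernel \<alpha> d x y \<partial>\<tau>) \<le> ennreal e" if e: "0 < e" for e
  proof -
    obtain i where i: "1 / Suc i < e" using reals_Archimedean[OF e] by (auto simp: inverse_eq_divide)
    obtain m where m: "\<And>x. x \<in> G \<Longrightarrow> g m x \<le> ennreal (1 / Suc i)" using G(3) by blast
    have "(\<integral>\<^sup>+y. near_kernel \<alpha> (1 / Suc m) x y \<partial>\<tau>) \<le> ennreal e" if "x \<in> K" for x
    proof -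
      have "(\<integral>\<^sup>+y. near_kernel \<alpha> (1 / Suc m) x y \<partial>\<tau>) \<le> g m x"
        unfolding \<tau>_def g_def by (rule nn_integral_density_indicator_le) (use Kb sets in auto)
      also have "\<dots> \<le> ennreal (1 / Suc i)" using m that K by auto
      also have "\<dots> \<le> ennreal e" using i by (intro ennreal_leI) auto
      finally show ?thesis .
    qed
    then show ?thesis by (intro exI[of _ "1 / Suc m"]) auto
  qed
  \<comment> \<open>\<open>small\<close> controls only the points of \<open>K\<close>;
    \<open>near_potential_uniformly_small\<close> extends it to all points, as
    \<open>continuous_potential\<close> demands.\<close>
  note cont = continuous_potential[OF \<alpha> \<tau>sets \<tau>fin near_potential_uniformly_small[OF \<alpha> \<tau>sets K(3) \<tau>K small]]
  have "energy \<alpha> \<tau> < \<infinity>"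
    using energy_density_indicator_le[OF rad Kb] en unfolding \<tau>_def by (rule le_less_trans)
  then have "(\<tau>, K) \<in> cont_pot_measures \<alpha> A R" if "K \<subseteq> A \<inter> cball 0 R" for A R
    using that K \<tau>K \<tau>rad cont by (simp add: cont_pot_measures_def)
  then show thesis using K that unfolding \<tau>_def by blast
qed

section \<open>Sets of inner capacity zero\<close>

text \<open>Otherwise the restriction of \<open>\<tau>\<close> to \<open>N\<close>, divided by its
  mass, would be a unit measure on \<open>E\<close>. Its energy is at most that of
  \<open>\<tau>\<close> times the squared inverse mass, hence finite, and the capacity of
  \<open>E\<close> would be positive.\<close>

lemma null_set_of_inner_cap_0:
  assumes cap: "inner_cap \<alpha> E = 0" and rad: "radon_pos \<tau>" and en: "energy \<alpha> \<tau> < \<infinity>"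
    and N: "N \<in> sets borel" "N \<subseteq> E" "emeasure \<tau> N < \<infinity>"
  shows "emeasure \<tau> N = 0"
proof (rule ccontr)
  assume nz: "emeasure \<tau> N \<noteq> 0"
  define c where "c = emeasure \<tau> N"
  have c: "c \<noteq> 0" "c \<noteq> top" using nz N by (auto simp: c_def)
  have ic: "inverse c < top" using c by (simp add: less_top[symmetric])
  have sets [measurable_cong]: "sets \<tau> = sets borel" using rad by (simp add: radon_pos_def)
  have [measurable]: "N \<in> sets borel" by fact
  have [measurable]: "potential \<alpha> \<tau> \<in> borel_measurable borel" using rad by measurable
  define \<rho> where "\<rho> = density \<tau> (\<lambda>x. inverse c * indicator N x)"
  have em: "emeasure \<rho> X = inverse c * emeasure \<tau> (N \<inter> X)" if "X \<in> sets borel" for X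
    using that unfolding \<rho>_def
    by (simp add: emeasure_density sets mult.assoc indicator_inter_arith[symmetric] nn_integral_cmult)
  have int: "(\<integral>\<^sup>+x. f x \<partial>\<rho>) \<le> inverse c * (\<integral>\<^sup>+x. f x \<partial>\<tau>)" if [measurable]: "f \<in> borel_measurable borel" for f
  proof -
    have "(\<integral>\<^sup>+x. f x \<partial>\<rho>) = (\<integral>\<^sup>+x. inverse c * indicator N x * f x \<partial>\<tau>)"
      unfolding \<rho>_def by (intro nn_integral_density) measurable
    also have "\<dots> \<le> (\<integral>\<^sup>+x. inverse c * f x \<partial>\<tau>)"
      by (intro nn_integral_mono) (auto simp: indicator_def)
    also have "\<dots> = inverse c * (\<integral>\<^sup>+x. f x \<partial>\<tau>)" by (rule nn_integral_cmult) measurable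
    finally show ?thesis .
  qed
  have mass: "emeasure \<rho> UNIV = 1"
    using em[of UNIV] ennreal_divide_self[of c] c
    by (simp add: c_def[symmetric] divide_ennreal_def mult.commute less_top)
  have "emeasure \<rho> X \<le> 1" for X
    using emeasure_mono[of X UNIV \<rho>] mass by (simp add: \<rho>_def sets)
  then have "emeasure \<rho> X < \<infinity>" for X by (rule le_less_trans) simp
  then have "radon_pos \<rho>" by (auto simp: radon_pos_def) (simp_all add: \<rho>_def sets)
  moreover have "energy \<alpha> \<rho> < \<infinity>"
  proof -
    have "energy \<alpha> \<rho> \<le> (\<integral>\<^sup>+x. inverse c * potential \<alpha> \<tau> x \<partial>\<rho>)"
      unfolding energy_def by (intro nn_integral_mono) (simp add: potential_def int)
    also have "\<dots> \<le> inverse c * (\<integral>\<^sup>+x. inverse c * potential \<alpha> \<tau> x \<partial>\<tau>)" by (rule int) measurable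
    also have "\<dots> = inverse c * (inverse c * energy \<alpha> \<tau>)"
      unfolding energy_def by (subst nn_integral_cmult) auto
    also have "\<dots> < \<infinity>" using ic en by (simp add: ennreal_mult_less_top)
    finally show ?thesis .
  qed
  moreover have "concentrated_on \<rho> E"
    unfolding concentrated_on_def using N em[of "UNIV - N"] by (intro bexI[of _ N]) auto
  ultimately have "\<rho> \<in> {\<mu> \<in> Eplus \<alpha> E. emeasure \<mu> UNIV = 1}" and fin: "energy \<alpha> \<rho> < \<infinity>"
    using mass by (auto simp: Eplus_def)
  then have "(INF \<mu> \<in> {\<mu> \<in> Eplus \<alpha> E. emeasure \<mu> UNIV = 1}. energy \<alpha> \<mu>) < \<infinity>"
    by (meson INF_lower le_less_trans)
  with cap show False by (simp add: inner_cap_def)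
qed

text \<open>The infimum over an empty family is infinity, and the inverse of infinity is 0.\<close>

lemma inner_cap_0_I:
  assumes "\<And>\<sigma>. \<sigma> \<in> Eplus \<alpha> E \<Longrightarrow> emeasure \<sigma> UNIV = 1 \<Longrightarrow> False"
  shows "inner_cap \<alpha> E = 0"
proof -
  have "{\<mu> \<in> Eplus \<alpha> E. emeasure \<mu> UNIV = 1} = {}" using assms by blast
  then show ?thesis unfolding inner_cap_def by (simp only: image_empty) simp
qed

text \<open>This serves to cut an exceptional subset of \<open>A\<close> down to \<open>A0\<close>,
  the easy half of the comparison of competitors.\<close>

lemma inner_cap_0_subset:
  assumes "inner_cap \<alpha> E = 0" "E' \<subseteq> E"
  shows "inner_cap \<alpha> E' = 0"
proof (rule inner_cap_0_I)
  fix \<sigma> assume \<sigma>: "\<sigma> \<in> Eplus \<alpha> E'" "emeasure \<sigma> UNIV = 1"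
  then obtain B where B: "B \<in> sets borel" "B \<subseteq> E'" "emeasure \<sigma> (UNIV - B) = 0"
    by (auto simp: Eplus_def concentrated_on_def)
  have sets: "sets \<sigma> = sets borel" using \<sigma> by (auto simp: Eplus_def radon_pos_def)
  have le: "emeasure \<sigma> B \<le> 1"
    using emeasure_mono[of B UNIV \<sigma>] \<sigma> by (simp add: sets)
  then have "emeasure \<sigma> B = 0"
    using \<sigma> B assms by (intro null_set_of_inner_cap_0[OF assms(1)]) (auto simp: Eplus_def le_less_trans)
  moreover have "emeasure \<sigma> UNIV \<le> emeasure \<sigma> B + emeasure \<sigma> (UNIV - B)"
    using emeasure_subadditive[of B \<sigma> "UNIV - B"] B by (simp add: sets Un_Diff_cancel)
  ultimately show False using \<sigma> B by simp
qed

section \<open>Domination by one kernel and convergence of integrals\<close>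

text \<open>Scaling against a pair of points at distance 1, where the kernel equals 1. It converts
  constants into multiples of the kernel on bounded regions.\<close>

lemma one_le_riesz_kernel:
  fixes x y :: "'a::euclidean_space"
  assumes "\<alpha> < real DIM('a)" "0 < r" "dist x y \<le> r"
  shows "1 \<le> ennreal (r powr (real DIM('a) - \<alpha>)) * riesz_kernel \<alpha> x y"
proof -
  obtain b :: 'a where "b \<in> Basis" using nonempty_Basis by blast
  then have b: "norm b = 1" by simp
  then have "b \<noteq> 0" by auto
  with b have "riesz_kernel \<alpha> 0 b = 1" by (simp add: riesz_kernel_def)
  then show ?thesis using riesz_kernel_le_scale[of \<alpha> r x y 0 b] assms b by simp
qed

text \<open>Within \<open>2 * R\<close> of the origin the potential is at most \<open>M\<close> and
  the kernel at \<open>x0\<close> is bounded below. Farther out, the distance from \<open>x\<close>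
  to any point of the carrier is comparable to that from \<open>x\<close> to \<open>x0\<close>. The
  constant does not depend on \<open>\<tau>\<close>, so it serves a whole sequence at once.\<close>

lemma potential_le_riesz_kernel:
  fixes x0 :: "'a::euclidean_space"
  assumes \<alpha>: "\<alpha> < real DIM('a)" and R: "0 < R"
  shows "\<exists>C<\<infinity>. \<forall>\<tau> K A x. (\<tau>, K) \<in> cont_pot_measures \<alpha> A R \<longrightarrow>
      (\<forall>y\<in>cball 0 (2 * R). potential \<alpha> \<tau> y \<le> ennreal M) \<longrightarrow>
      potential \<alpha> \<tau> x \<le> C * riesz_kernel \<alpha> x0 x"
proof -
  define p where "p = real DIM('a) - \<alpha>"
  \<comment> \<open>For \<open>norm x > 2 * R\<close> and \<open>norm y \<le> R\<close>, the
    distance from \<open>x\<close> to \<open>y\<close> is at least \<open>R\<close> and at least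
    \<open>norm x / 2\<close>. The summand 2 accounts for \<open>norm x\<close>, the other one for
    \<open>norm x0\<close>.\<close>
  define c where "c = 2 + norm x0 / R"
  define r where "r = norm x0 + 2 * R"
  \<comment> \<open>The first summand handles points outside the ball of radius
    \<open>2 * R\<close>, the second one those inside.\<close>
  define C where "C = ennreal (c powr p) * ennreal (R powr p) * ennreal M + ennreal M * ennreal (r powr p)"
  have cr: "0 < c" "0 < r" using R by (auto simp: c_def r_def intro: add_pos_nonneg add_nonneg_pos)
  have "C < \<infinity>" unfolding C_def by (simp add: ennreal_mult_less_top)
  moreover have "potential \<alpha> \<tau> x \<le> C * riesz_kernel \<alpha> x0 x"
    if \<tau>: "(\<tau>, K) \<in> cont_pot_measures \<alpha> A R"
      and M: "\<forall>y\<in>cball 0 (2 * R). potential \<alpha> \<tau> y \<le> ennreal M" for \<tau> K A x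
  proof -
    have sets [measurable_cong]: "sets \<tau> = sets borel" and KR: "K \<subseteq> cball 0 R"
      and K: "compact K" "emeasure \<tau> (- K) = 0"
      using \<tau> by (auto simp: cont_pot_measures_def radon_pos_def)
    have AEK: "AE y in \<tau>. y \<in> K"
    proof (rule AE_I)
      show "- K \<in> sets \<tau>" using compact_imp_closed[OF K(1)] sets by simp
    qed (use K in auto)
    show ?thesis
    proof (cases "norm x \<le> 2 * R")
      case True
      then have "dist x0 x \<le> r" unfolding r_def using norm_triangle_ineq4[of x0 x] by (simp add: dist_norm)
      then have "1 \<le> ennreal (r powr p) * riesz_kernel \<alpha> x0 x"
        unfolding p_def using \<alpha> cr by (intro one_le_riesz_kernel) auto
      then have "ennreal M * 1 \<le> ennreal M * (ennreal (r powr p) * riesz_kernel \<alpha> x0 x)"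
        by (intro mult_left_mono) auto
      then have "potential \<alpha> \<tau> x \<le> ennreal M * ennreal (r powr p) * riesz_kernel \<alpha> x0 x"
        using bspec[OF M, of x] True by (simp add: mult.assoc)
      also have "\<dots> \<le> C * riesz_kernel \<alpha> x0 x" unfolding C_def by (intro mult_right_mono) auto
      finally show ?thesis .
    next
      case False
      let ?a = "ennreal (c powr p) * riesz_kernel \<alpha> x0 x * ennreal (R powr p)"
      have "potential \<alpha> \<tau> x \<le> (\<integral>\<^sup>+y. ?a * riesz_kernel \<alpha> 0 y \<partial>\<tau>)"
        unfolding potential_def
      proof (intro nn_integral_mono_AE, use AEK in eventually_elim)
        case (elim y)
        then have y: "norm y \<le> R" using KR by auto
        have xy: "norm x - norm y \<le> dist x y" by (simp add: dist_norm norm_triangle_ineq2)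
        have "norm x0 = norm x0 / R * R" using R by simp
        also have "\<dots> \<le> norm x0 / R * dist x y"
          using y xy False R by (intro mult_left_mono) auto
        finally have "norm x0 + norm x \<le> c * dist x y"
          using y xy False by (simp add: c_def algebra_simps)
        then have "dist x0 x \<le> c * dist x y" using norm_triangle_ineq4[of x0 x] by (simp add: dist_norm)
        \<comment> \<open>The factor 1 will be replaced by a multiple of the kernel at the origin.
          Its integral is a multiple of \<open>potential \<alpha> \<tau> 0\<close>, so
          \<open>M\<close> bounds the total mass as well.\<close>
        then have "riesz_kernel \<alpha> x y \<le> ennreal (c powr p) * riesz_kernel \<alpha> x0 x * 1"
          unfolding p_def using riesz_kernel_le_scale[OF \<alpha> cr(1)] by simp
        also have "\<dots> \<le> ennreal (c powr p) * riesz_kernel \<alpha> x0 x * (ennreal (R powr p) * riesz_kernel \<alpha> 0 y)"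
          unfolding p_def using \<alpha> R y by (intro mult_left_mono one_le_riesz_kernel) auto
        finally show ?case by (simp add: mult.assoc)
      qed
      also have "\<dots> = ?a * potential \<alpha> \<tau> 0"
        unfolding potential_def by (rule nn_integral_cmult) measurable
      also have "\<dots> \<le> ?a * ennreal M" using bspec[OF M, of 0] R by (intro mult_left_mono) auto
      also have "\<dots> = (ennreal (c powr p) * ennreal (R powr p) * ennreal M) * riesz_kernel \<alpha> x0 x"
        by (simp add: mult_ac)
      also have "\<dots> \<le> C * riesz_kernel \<alpha> x0 x" unfolding C_def by (intro mult_right_mono) auto
      finally show ?thesis .
    qed
  qed
  ultimately show ?thesis by blast
qed

text \<open>Dominated convergence. The dominating function is a multiple of the kernel at a point
  \<open>x0\<close> where the potential of \<open>\<nu>\<close> is finite, so its integral against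
  \<open>\<nu>\<close> is finite.\<close>

lemma tendsto_nn_integral_potential:
  fixes \<nu> :: "'a::euclidean_space measure"
  assumes \<alpha>: "\<alpha> < real DIM('a)" and R: "0 < R" and \<nu>: "\<nu> \<in> Mplus \<alpha>"
    and \<tau>: "(\<tau>, K) \<in> cont_pot_measures \<alpha> A R"
    and t: "\<And>k. (t k, L k) \<in> cont_pot_measures \<alpha> A R"
    and close: "\<And>k x. x \<in> cball 0 (real k) \<Longrightarrow>
      \<bar>enn2real (potential \<alpha> (t k) x) - enn2real (potential \<alpha> \<tau> x)\<bar> < 1 / Suc k"
  shows "(\<lambda>k. \<integral>\<^sup>+x. potential \<alpha> (t k) x \<partial>\<nu>) \<longlonglongrightarrow> (\<integral>\<^sup>+x. potential \<alpha> \<tau> x \<partial>\<nu>)" (is ?lim)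
    and "(\<integral>\<^sup>+x. potential \<alpha> \<tau> x \<partial>\<nu>) < \<infinity>" (is ?fin)
proof -
  define f where "f x = enn2real (potential \<alpha> \<tau> x)" for x
  define g where "g k x = enn2real (potential \<alpha> (t k) x)" for k x
  have f: "potential \<alpha> \<tau> x = ennreal (f x)" for x
    using \<tau> by (auto simp: f_def cont_pot_measures_def)
  have g: "potential \<alpha> (t k) x = ennreal (g k x)" for k x
    using t[of k] by (auto simp: g_def cont_pot_measures_def)
  have cont: "continuous_on UNIV f" using \<tau> by (auto simp: f_def cont_pot_measures_def)
  have sets [measurable_cong]: "sets \<nu> = sets borel" using \<nu> by (simp add: Mplus_def radon_pos_def)
  have meas\<tau>: "potential \<alpha> \<tau> \<in> borel_measurable \<nu>"
    using \<tau> potential_measurable[of \<tau> \<alpha>] by (auto simp: cont_pot_measures_def cong: measurable_cong_sets)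
  have meast: "potential \<alpha> (t k) \<in> borel_measurable \<nu>" for k
    using t[of k] potential_measurable[of "t k" \<alpha>] by (auto simp: cont_pot_measures_def cong: measurable_cong_sets)
  obtain x0 where x0: "potential \<alpha> \<nu> x0 < \<infinity>" using \<nu> by (auto simp: Mplus_def)
  have "bounded (f ` cball 0 (2 * R))"
    by (intro compact_imp_bounded compact_continuous_image continuous_on_subset[OF cont]) auto
  then obtain M0 where "\<forall>z\<in>f ` cball 0 (2 * R). norm z \<le> M0"
    unfolding bounded_iff by blast
  then have M0: "\<And>x. x \<in> cball 0 (2 * R) \<Longrightarrow> \<bar>f x\<bar> \<le> M0" by simp
  obtain C where C: "C < \<infinity>" "\<And>\<tau> K x. (\<tau>, K) \<in> cont_pot_measures \<alpha> A R \<Longrightarrow>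
      \<forall>y\<in>cball 0 (2 * R). potential \<alpha> \<tau> y \<le> ennreal (M0 + 1) \<Longrightarrow>
      potential \<alpha> \<tau> x \<le> C * riesz_kernel \<alpha> x0 x"
    using potential_le_riesz_kernel[OF \<alpha> R, of "M0 + 1" x0] by blast
  have "(\<integral>\<^sup>+x. C * riesz_kernel \<alpha> x0 x \<partial>\<nu>) = C * potential \<alpha> \<nu> x0"
    unfolding potential_def by (rule nn_integral_cmult) measurable
  then have w: "(\<integral>\<^sup>+x. C * riesz_kernel \<alpha> x0 x \<partial>\<nu>) < \<infinity>"
    using C(1) x0 by (simp add: ennreal_mult_less_top)
  have dom\<tau>: "potential \<alpha> \<tau> x \<le> C * riesz_kernel \<alpha> x0 x" for x
  proof (rule C(2)[OF \<tau>], rule ballI)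
    show "potential \<alpha> \<tau> y \<le> ennreal (M0 + 1)" if "y \<in> cball 0 (2 * R)" for y
      using M0[OF that] unfolding f by (intro ennreal_leI) auto
  qed
  then have "(\<integral>\<^sup>+x. potential \<alpha> \<tau> x \<partial>\<nu>) \<le> (\<integral>\<^sup>+x. C * riesz_kernel \<alpha> x0 x \<partial>\<nu>)"
    by (intro nn_integral_mono)
  with w show ?fin by (rule le_less_trans[rotated])
  \<comment> \<open>From index \<open>m\<close> on, the ball of radius \<open>2 * R\<close> lies in
    the ball of approximation, where the error is below 1; this gives the common bound
    \<open>M0 + 1\<close>. The limit is then taken along the shifted sequence.\<close>
  obtain m :: nat where m: "2 * R \<le> real m" using real_arch_simple by blast
  have domt: "potential \<alpha> (t (k + m)) x \<le> C * riesz_kernel \<alpha> x0 x" for k x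
  proof (rule C(2)[OF t], rule ballI)
    show "potential \<alpha> (t (k + m)) y \<le> ennreal (M0 + 1)" if y: "y \<in> cball 0 (2 * R)" for y
    proof -
      have "\<bar>g (k + m) y - f y\<bar> < 1 / Suc (k + m)"
        unfolding f_def g_def using y m by (intro close) auto
      also have "\<dots> \<le> 1" by simp
      finally show ?thesis using M0[OF y] unfolding g by (intro ennreal_leI) auto
    qed
  qed
  have pt: "(\<lambda>k. potential \<alpha> (t k) x) \<longlonglongrightarrow> potential \<alpha> \<tau> x" for x
  proof -
    obtain n :: nat where n: "norm x \<le> real n" using real_arch_simple by blast
    have "eventually (\<lambda>k. norm (g k x - f x) \<le> inverse (real (Suc k))) sequentially"
      using eventually_ge_at_top[of n]
    proof eventually_elim
      case (elim k)
      then have "\<bar>g k x - f x\<bar> < 1 / Suc k" unfolding f_def g_def using n by (intro close) auto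
      then show ?case by (simp add: inverse_eq_divide)
    qed
    then have "(\<lambda>k. g k x - f x) \<longlonglongrightarrow> 0"
      by (rule Lim_null_comparison) (rule LIMSEQ_inverse_real_of_nat)
    then show ?thesis unfolding f g by (intro tendsto_ennrealI) (rule LIM_zero_cancel)
  qed
  have "(\<lambda>k. \<integral>\<^sup>+x. potential \<alpha> (t (k + m)) x \<partial>\<nu>) \<longlonglongrightarrow> (\<integral>\<^sup>+x. potential \<alpha> \<tau> x \<partial>\<nu>)"
  proof (rule nn_integral_dominated_convergence[where w = "\<lambda>x. C * riesz_kernel \<alpha> x0 x"])
    show "AE x in \<nu>. (\<lambda>k. potential \<alpha> (t (k + m)) x) \<longlonglongrightarrow> potential \<alpha> \<tau> x"
      using LIMSEQ_ignore_initial_segment[OF pt] by auto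
  qed (use meas\<tau> meast w domt in auto)
  then show ?lim by (rule LIMSEQ_offset)
qed

section \<open>Transfer of nearly-everywhere inequalities from \<open>A0\<close> to
  \<open>A\<close>\<close>

text \<open>If the inequality failed on a part of \<open>A\<close> of positive inner capacity, some
  \<open>\<tau>\<close> carried by that part would have continuous potential and integrate the two
  potentials in the strict opposite order. The approximants of \<open>\<tau>\<close> live on
  \<open>A0\<close> and integrate them in the asserted order, which survives the limit.\<close>

lemma nearly_everywhere_potential_transfer:
  fixes A :: "'a::euclidean_space set"
  assumes \<alpha>: "\<alpha> < real DIM('a)" and \<mu>: "\<mu> \<in> Mplus \<alpha>" and \<nu>: "\<nu> \<in> Mplus \<alpha>"
    and D: "\<And>R. D R \<subseteq> cont_pot_measures \<alpha> A (real R)"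
    and dense: "\<And>R s k. s \<in> cont_pot_measures \<alpha> A (real R) \<Longrightarrow> \<exists>t\<in>D R. \<forall>x\<in>cball 0 (real k).
       \<bar>enn2real (potential \<alpha> (fst t) x) - enn2real (potential \<alpha> (fst s) x)\<bar> < 1 / Suc k"
    and A0: "\<And>R t. t \<in> D R \<Longrightarrow> snd t \<subseteq> A0"
    and ne: "nearly_everywhere \<alpha> A0 (\<lambda>y. potential \<alpha> \<mu> y \<le> potential \<alpha> \<nu> y)"
  shows "nearly_everywhere \<alpha> A (\<lambda>y. potential \<alpha> \<mu> y \<le> potential \<alpha> \<nu> y)"
proof -
  have rad: "radon_pos \<mu>" "radon_pos \<nu>" using \<mu> \<nu> by (auto simp: Mplus_def)
  note [measurable] = potential_measurable[OF rad(1)] potential_measurable[OF rad(2)]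
  define N where "N = {x. potential \<alpha> \<nu> x < potential \<alpha> \<mu> x}"
  have N: "N \<in> sets borel" unfolding N_def by measurable
  have "inner_cap \<alpha> (A \<inter> N) = 0"
  proof (rule inner_cap_0_I)
    fix \<sigma> assume \<sigma>: "\<sigma> \<in> Eplus \<alpha> (A \<inter> N)" "emeasure \<sigma> UNIV = 1"
    then obtain B where B: "B \<in> sets borel" "B \<subseteq> A \<inter> N" "emeasure \<sigma> (UNIV - B) = 0"
      by (auto simp: Eplus_def concentrated_on_def)
    have \<sigma>': "radon_pos \<sigma>" "energy \<alpha> \<sigma> < \<infinity>" using \<sigma> by (auto simp: Eplus_def)
    obtain K where K: "compact K" "K \<subseteq> B" "0 < emeasure \<sigma> K"
      "\<And>A R. K \<subseteq> A \<inter> cball 0 R \<Longrightarrow> (density \<sigma> (indicator K), K) \<in> cont_pot_measures \<alpha> A R"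
      using exists_cont_pot_restriction[OF \<alpha> \<sigma>' \<sigma>(2) B(1,3)] by blast
    define \<tau> where "\<tau> = density \<sigma> (indicator K)"
    obtain b where b: "\<And>x. x \<in> K \<Longrightarrow> norm x \<le> b"
      using compact_imp_bounded[OF K(1)] by (auto simp: bounded_iff)
    obtain n :: nat where n: "b \<le> real n" using real_arch_simple by blast
    \<comment> \<open>The successor makes the radius positive even if \<open>n\<close> is 0.\<close>
    define R where "R = Suc n"
    have \<tau>: "(\<tau>, K) \<in> cont_pot_measures \<alpha> A (real R)"
      unfolding \<tau>_def using K(2) B b n by (intro K(4)) (force simp: R_def)
    then have \<tau>rad: "radon_pos \<tau>" by (simp add: cont_pot_measures_def)
    have "\<forall>k. \<exists>t. t \<in> D R \<and> (\<forall>x\<in>cball 0 (real k).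
       \<bar>enn2real (potential \<alpha> (fst t) x) - enn2real (potential \<alpha> \<tau> x)\<bar> < 1 / Suc k)"
      using dense[OF \<tau>] unfolding fst_conv by blast
    from choice[OF this] obtain t where t: "\<And>k. t k \<in> D R"
      "\<And>k x. x \<in> cball 0 (real k) \<Longrightarrow>
        \<bar>enn2real (potential \<alpha> (fst (t k)) x) - enn2real (potential \<alpha> \<tau> x)\<bar> < 1 / Suc k"
      by blast
    have tS: "(fst (t k), snd (t k)) \<in> cont_pot_measures \<alpha> A (real R)" for k
      using t(1) D by auto
    have R: "0 < real R" by (simp add: R_def)
    note lim = tendsto_nn_integral_potential[OF \<alpha> R _ \<tau> tS t(2)]
    have le: "(\<integral>\<^sup>+x. potential \<alpha> (fst (t k)) x \<partial>\<mu>) \<le> (\<integral>\<^sup>+x. potential \<alpha> (fst (t k)) x \<partial>\<nu>)" for k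
    proof -
      let ?t = "fst (t k)" and ?L = "snd (t k)"
      have L: "compact ?L" "emeasure ?t (- ?L) = 0" "radon_pos ?t" "energy \<alpha> ?t < \<infinity>" "?L \<subseteq> A0"
        using tS[of k] A0[OF t(1)] by (auto simp: cont_pot_measures_def)
      obtain E where E: "inner_cap \<alpha> E = 0" "\<And>x. x \<in> A0 - E \<Longrightarrow> potential \<alpha> \<mu> x \<le> potential \<alpha> \<nu> x"
        using ne by (auto simp: nearly_everywhere_def)
      have sets: "sets ?t = sets borel" using L by (simp add: radon_pos_def)
      have Lb: "?L \<in> sets borel" using L by (simp add: borel_compact)
      have "emeasure ?t (?L \<inter> N) = 0"
      proof (rule null_set_of_inner_cap_0[OF E(1) L(3,4)])
        \<comment> \<open>\<open>E\<close> itself may fail to be measurable; the Borel set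
          \<open>?L \<inter> N\<close> inside it is all that has to be null.\<close>
        show "?L \<inter> N \<subseteq> E" using E(2) L(5) by (force simp: N_def not_less[symmetric])
        have "emeasure ?t (?L \<inter> N) \<le> emeasure ?t ?L" using Lb by (intro emeasure_mono) (auto simp: sets)
        also have "\<dots> < \<infinity>" using L by (auto simp: radon_pos_def)
        finally show "emeasure ?t (?L \<inter> N) < \<infinity>" .
      qed (use Lb N in auto)
      then have "emeasure ?t (- ?L \<union> (?L \<inter> N)) = 0"
        using L Lb N by (intro emeasure_Un_null_set[THEN trans]) (auto simp: null_sets_def sets)
      then have ae: "AE x in ?t. potential \<alpha> \<mu> x \<le> potential \<alpha> \<nu> x"
        using Lb N by (intro AE_I[of _ _ "- ?L \<union> (?L \<inter> N)"]) (auto simp: N_def sets)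
      show ?thesis
        unfolding nn_integral_potential_commute[OF L(3) rad(1)] nn_integral_potential_commute[OF L(3) rad(2)]
        by (rule nn_integral_mono_AE[OF ae])
    qed
    have "(\<integral>\<^sup>+x. potential \<alpha> \<tau> x \<partial>\<mu>) \<le> (\<integral>\<^sup>+x. potential \<alpha> \<tau> x \<partial>\<nu>)"
      using le by (intro LIMSEQ_le[OF lim(1)[OF \<mu>] lim(1)[OF \<nu>]]) auto
    then have "(\<integral>\<^sup>+x. potential \<alpha> \<mu> x \<partial>\<tau>) \<le> (\<integral>\<^sup>+x. potential \<alpha> \<nu> x \<partial>\<tau>)"
      by (simp add: nn_integral_potential_commute[OF \<tau>rad] rad)
    \<comment> \<open>All mass of \<open>\<tau>\<close> lies on \<open>K\<close>, a subset of
      \<open>N\<close>, and this mass is positive. Strictness survives integration because the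
      smaller integral is finite: by reciprocity it is the integral of
      \<open>potential \<alpha> \<tau>\<close> against \<open>\<nu>\<close>.\<close>
    moreover have "(\<integral>\<^sup>+x. potential \<alpha> \<nu> x \<partial>\<tau>) < (\<integral>\<^sup>+x. potential \<alpha> \<mu> x \<partial>\<tau>)"
    proof (rule nn_integral_less)
      have sets [measurable_cong]: "sets \<tau> = sets borel" using \<tau>rad by (simp add: radon_pos_def)
      show "potential \<alpha> \<nu> \<in> borel_measurable \<tau>" "potential \<alpha> \<mu> \<in> borel_measurable \<tau>" by measurable
      show "(\<integral>\<^sup>+x. potential \<alpha> \<nu> x \<partial>\<tau>) \<noteq> \<infinity>"
        using lim(2)[OF \<nu>] by (simp add: nn_integral_potential_commute[OF \<tau>rad rad(2)] less_top)
      have s\<sigma>: "sets \<sigma> = sets borel" using \<sigma>' by (simp add: radon_pos_def)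
      have Kb: "K \<in> sets \<sigma>" using K(1) s\<sigma> by (simp add: borel_compact)
      have AE\<tau>: "(AE x in \<tau>. P x) \<longleftrightarrow> (AE x in \<sigma>. x \<in> K \<longrightarrow> P x)" for P
        unfolding \<tau>_def using Kb by (subst AE_density) (auto simp: indicator_def)
      show "AE x in \<tau>. potential \<alpha> \<nu> x \<le> potential \<alpha> \<mu> x"
        unfolding AE\<tau> using K(2) B(2) by (intro AE_I2) (auto simp: N_def)
      show "\<not> (AE x in \<tau>. potential \<alpha> \<mu> x \<le> potential \<alpha> \<nu> x)"
      proof
        assume "AE x in \<tau>. potential \<alpha> \<mu> x \<le> potential \<alpha> \<nu> x"
        then have "AE x in \<sigma>. x \<notin> K"
          unfolding AE\<tau> by eventually_elim (use K(2) B(2) in \<open>auto simp: N_def not_less[symmetric]\<close>)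
        then have "emeasure \<sigma> K = 0"
          using Kb by (simp add: AE_iff_null_sets[symmetric] null_sets_def[symmetric] flip: null_setsD1)
        with K(3) show False by simp
      qed
    qed
    ultimately show False by simp
  qed
  then show ?thesis
    unfolding nearly_everywhere_def by (intro exI[of _ "A \<inter> N"]) (auto simp: N_def not_less)
qed

section \<open>Dirac measures and construction of the K_sigma set\<close>

text \<open>The potential of a Dirac measure is finite away from its atom. Hence the equality of
  balayages applies to Dirac measures and yields the equality of regular points.\<close>

lemma return_in_Mplus: "return borel (y::'a::euclidean_space) \<in> Mplus \<alpha>"
proof -
  obtain b :: 'a where "b \<in> Basis" using nonempty_Basis by blast
  then have "y + b \<noteq> y" by auto
  then have "potential \<alpha> (return borel y) (y + b) < \<infinity>"
    unfolding potential_def by (subst nn_integral_return) (auto simp: riesz_kernel_def)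
  moreover have "radon_pos (return borel y)"
    by (auto simp: radon_pos_def borel_compact indicator_def)
  ultimately show ?thesis by (auto simp: Mplus_def)
qed

theorem mainTheorem17:
  fixes \<alpha> :: real and A :: "'a::euclidean_space set"
  assumes "DIM('a) \<ge> 3" and "0 < \<alpha>" and "\<alpha> \<le> 2"
  shows "\<exists>A0 \<subseteq> A. (\<exists>K :: nat \<Rightarrow> 'a set. (\<forall>i. compact (K i)) \<and> A0 = (\<Union>i. K i))
           \<and> (\<forall>\<mu> \<in> Mplus \<alpha>. balayage \<alpha> \<mu> A = balayage \<alpha> \<mu> A0)
           \<and> regular_points \<alpha> A = regular_points \<alpha> A0"
proof -
  have \<alpha>: "\<alpha> < real DIM('a)" using assms by linarith
  let ?S = "\<lambda>R::nat. cont_pot_measures \<alpha> A (real R)"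
  let ?F = "\<lambda>s x. enn2real (potential \<alpha> (fst s) x)"
  have "\<forall>R. \<exists>D. countable D \<and> D \<subseteq> ?S R \<and>
     (\<forall>s\<in>?S R. \<forall>k. \<exists>t\<in>D. \<forall>x\<in>cball 0 (real k). \<bar>?F t x - ?F s x\<bar> < 1 / Suc k)"
  proof
    fix R
    have cont: "continuous_on UNIV (?F s)" if "s \<in> ?S R" for s
      using that by (auto simp: cont_pot_measures_def)
    obtain D where "countable D" "D \<subseteq> ?S R"
      "\<forall>s\<in>?S R. \<forall>k. \<exists>t\<in>D. \<forall>x\<in>cball 0 (real k). \<bar>?F t x - ?F s x\<bar> < 1 / Suc k"
      by (rule countable_locally_uniformly_dense[of "?S R" ?F, OF cont])
    then show "\<exists>D. countable D \<and> D \<subseteq> ?S R \<and>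
     (\<forall>s\<in>?S R. \<forall>k. \<exists>t\<in>D. \<forall>x\<in>cball 0 (real k). \<bar>?F t x - ?F s x\<bar> < 1 / Suc k)" by blast
  qed
  from choice[OF this] obtain D where D: "\<forall>R. countable (D R) \<and> D R \<subseteq> ?S R \<and>
     (\<forall>s\<in>?S R. \<forall>k. \<exists>t\<in>D R. \<forall>x\<in>cball 0 (real k). \<bar>?F t x - ?F s x\<bar> < 1 / Suc k)" ..
  have count: "countable (D R)" for R by (rule conjunct1[OF spec[OF D]])
  have DS: "D R \<subseteq> ?S R" for R by (rule conjunct1[OF conjunct2[OF spec[OF D]]])
  have dense: "\<exists>t\<in>D R. \<forall>x\<in>cball 0 (real k). \<bar>?F t x - ?F s x\<bar> < 1 / Suc k" if "s \<in> ?S R" for R s k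
    using bspec[OF conjunct2[OF conjunct2[OF spec[OF D]]] that] by (rule spec)
  \<comment> \<open>Adding the empty set, which is compact, keeps the family nonempty, so that it
    can be enumerated by the natural numbers even if \<open>A\<close> carries no suitable
    measure.\<close>
  define \<K> where "\<K> = insert {} (\<Union>R. snd ` D R)"
  define K where "K = from_nat_into \<K>"
  have "countable \<K>" "\<K> \<noteq> {}" using count by (auto simp: \<K>_def)
  then have rK: "range K = \<K>" unfolding K_def by (simp add: range_from_nat_into)
  have \<K>: "compact L \<and> L \<subseteq> A" if "L \<in> \<K>" for L
    using that DS by (force simp: \<K>_def cont_pot_measures_def)
  define A0 where "A0 = (\<Union>i. K i)"
  have sub: "A0 \<subseteq> A" unfolding A0_def using \<K> rK by blast
  have comp: "compact (K i)" for i using \<K>[of "K i"] rK by blast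
  have ne_iff: "nearly_everywhere \<alpha> A (\<lambda>y. potential \<alpha> \<mu> y \<le> potential \<alpha> \<nu> y) \<longleftrightarrow>
      nearly_everywhere \<alpha> A0 (\<lambda>y. potential \<alpha> \<mu> y \<le> potential \<alpha> \<nu> y)"
    if "\<mu> \<in> Mplus \<alpha>" "\<nu> \<in> Mplus \<alpha>" for \<mu> \<nu>
  proof
    assume "nearly_everywhere \<alpha> A (\<lambda>y. potential \<alpha> \<mu> y \<le> potential \<alpha> \<nu> y)"
    then obtain E where E: "inner_cap \<alpha> E = 0" "\<forall>x\<in>A - E. potential \<alpha> \<mu> x \<le> potential \<alpha> \<nu> x"
      by (auto simp: nearly_everywhere_def)
    then show "nearly_everywhere \<alpha> A0 (\<lambda>y. potential \<alpha> \<mu> y \<le> potential \<alpha> \<nu> y)"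
      unfolding nearly_everywhere_def using sub inner_cap_0_subset[OF E(1), of "E \<inter> A0"]
      by (intro exI[of _ "E \<inter> A0"]) auto
  next
    assume "nearly_everywhere \<alpha> A0 (\<lambda>y. potential \<alpha> \<mu> y \<le> potential \<alpha> \<nu> y)"
    moreover have "snd t \<subseteq> A0" if "t \<in> D R" for R t
      using that rK unfolding A0_def \<K>_def by blast
    ultimately show "nearly_everywhere \<alpha> A (\<lambda>y. potential \<alpha> \<mu> y \<le> potential \<alpha> \<nu> y)"
      using nearly_everywhere_potential_transfer[OF \<alpha> that DS dense] by blast
  qed
  have bal: "balayage \<alpha> \<mu> A = balayage \<alpha> \<mu> A0" if "\<mu> \<in> Mplus \<alpha>" for \<mu>
  proof -
    \<comment> \<open>Equal families of competitors make the two \<open>is_balayage\<close>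
      predicates identical, so the definite descriptions coincide.\<close>
    have "{\<nu> \<in> Mplus \<alpha>. nearly_everywhere \<alpha> A (\<lambda>y. potential \<alpha> \<mu> y \<le> potential \<alpha> \<nu> y)} =
      {\<nu> \<in> Mplus \<alpha>. nearly_everywhere \<alpha> A0 (\<lambda>y. potential \<alpha> \<mu> y \<le> potential \<alpha> \<nu> y)}"
      using ne_iff[OF that] by blast
    then show ?thesis unfolding balayage_def is_balayage_def by (simp only:)
  qed
  have "regular_points \<alpha> A = regular_points \<alpha> A0"
    unfolding regular_points_def by (simp add: bal[OF return_in_Mplus])
  with sub comp bal show ?thesis unfolding A0_def by blast
qed

end
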